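(* Let $\mathfrak{V}$ be a vessel with $\sigma_1$ invertible. Then $\mathfrak{V}$ satisfies the $VR$ conditions if and only if it satisfies the $VR_*$ conditions, where: the $VR$ conditions are, for all $j,k=2,\ldots,d$: $[\sigma_1^{-1}\sigma_j,\sigma_1^{-1}\sigma_k]=0$; $[\sigma_1^{-1}\gamma_{1j},\sigma_1^{-1}\gamma_{1k}]=0$; $[\sigma_1^{-1}\sigma_k,\sigma_1^{-1}\gamma_{1j}]=[\sigma_1^{-1}\sigma_j,\sigma_1^{-1}\gamma_{1k}]$; $\gamma_{jk}=\sigma_j\sigma_1^{-1}\gamma_{1k}-\sigma_k\sigma_1^{-1}\gamma_{1j}$; the $VR_*$ conditions are, for all $j,k=2,\ldots,d$: $[\sigma_1^{-1}\sigma_j,\sigma_1^{-1}\sigma_k]=0$; $[\sigma_1^{-1}\gamma_{*1j},\sigma_1^{-1}\gamma_{*1k}]=0$; $[\sigma_1^{-1}\sigma_k,\sigma_1^{-1}\gamma_{*1j}]=[\sigma_1^{-1}\sigma_j,\sigma_1^{-1}\gamma_{*1k}]$; $\gamma_{*jk}=\sigma_j\sigma_1^{-1}\gamma_{*1k}-\sigma_k\sigma_1^{-1}\gamma_{*1j}$.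
   Context: A (Livsic commutative operator) vessel is a collection $\mathfrak{V}=(\mathcal{H},\mathcal{E},\Phi,\{A_j\},\{\sigma_j\},\{\gamma_{jk}\},\{\gamma_{*jk}\})$, where $\mathcal{H},\mathcal{E}$ are separable Hilbert spaces, $A_1,\ldots,A_d$ are commuting bounded (not necessarily selfadjoint) operators on $\mathcal{H}$, $\Phi:\mathcal{H}\to\mathcal{E}$ is bounded, and $\sigma_j,\gamma_{jk},\gamma_{*jk}$ ($j,k=1,\ldots,d$) are bounded selfadjoint operators on $\mathcal{E}$ such that for all $j,k$: $A_k-A_k^*=i\Phi^*\sigma_k\Phi$; $\gamma_{jk}=-\gamma_{kj}$, $\gamma_{*jk}=-\gamma_{*kj}$; $\sigma_j\Phi A_k^*-\sigma_k\Phi A_j^*=\gamma_{jk}\Phi$; $\sigma_j\Phi A_k-\sigma_k\Phi A_j=\gamma_{*jk}\Phi$; $\gamma_{*jk}-\gamma_{jk}=i(\sigma_j\Phi\Phi^*\sigma_k-\sigma_k\Phi\Phi^*\sigma_j)$. *)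

theory Defs
  imports "HOL-Analysis.Analysis"
begin

section \<open>Complex Hilbert spaces\<close>

class scaleC =
  fixes scaleC :: "complex \<Rightarrow> 'a \<Rightarrow> 'a"  (infixr \<open>*\<^sub>C\<close> 75)

text \<open>The inner product is linear in the first argument. Positive definiteness follows from
  \<open>norm_eq_sqrt_cinner\<close>, because the norm of the class \<open>real_normed_vector\<close> is
  nonnegative and vanishes only at 0.\<close>

class complex_inner = real_normed_vector + scaleC +
  fixes cinner :: "'a \<Rightarrow> 'a \<Rightarrow> complex"
  assumes scaleC_add_right: "c *\<^sub>C (x + y) = c *\<^sub>C x + c *\<^sub>C y"
    and scaleC_add_left: "(b + c) *\<^sub>C x = b *\<^sub>C x + c *\<^sub>C x"
    and scaleC_scaleC: "b *\<^sub>C c *\<^sub>C x = (b * c) *\<^sub>C x"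
    and scaleR_scaleC: "r *\<^sub>R x = complex_of_real r *\<^sub>C x"
    and cinner_commute: "cinner x y = cnj (cinner y x)"
    and cinner_add_left: "cinner (x + y) z = cinner x z + cinner y z"
    and cinner_scaleC_left: "cinner (c *\<^sub>C x) y = c * cinner x y"
    and norm_eq_sqrt_cinner: "norm x = sqrt (Re (cinner x x))"

class chilbert_space = complex_inner + complete_space

lemma (in complex_inner) scaleC_uminus_right: "c *\<^sub>C (- x) = - (c *\<^sub>C x)"
proof -
  have "c *\<^sub>C 0 + c *\<^sub>C 0 = c *\<^sub>C 0"
    using scaleC_add_right[of c 0 0] by simp
  then have "c *\<^sub>C 0 = 0"
    by simp
  then have "c *\<^sub>C x + c *\<^sub>C (- x) = 0"
    using scaleC_add_right[of c x "- x"] by simp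
  then show ?thesis
    by (simp add: eq_neg_iff_add_eq_0 add.commute)
qed

lemma (in complex_inner) scaleC_commute: "b *\<^sub>C c *\<^sub>C x = c *\<^sub>C b *\<^sub>C x"
  by (simp add: scaleC_scaleC mult.commute)

section \<open>Bounded complex-linear operators\<close>

definition bounded_clinear :: "('a::complex_inner \<Rightarrow> 'b::complex_inner) \<Rightarrow> bool" where
  "bounded_clinear f \<longleftrightarrow> bounded_linear f \<and> (\<forall>c x. f (c *\<^sub>C x) = c *\<^sub>C f x)"

lemma bounded_linear_scaleC: "bounded_linear (\<lambda>x::'a::complex_inner. c *\<^sub>C x)"
proof (rule bounded_linear_intro[where K = "cmod c"])
  fix x y :: 'a and r :: real
  show "c *\<^sub>C (x + y) = c *\<^sub>C x + c *\<^sub>C y"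
    by (rule scaleC_add_right)
  show "c *\<^sub>C (r *\<^sub>R x) = r *\<^sub>R (c *\<^sub>C x)"
    by (simp only: scaleR_scaleC scaleC_commute)
  have "cinner (c *\<^sub>C x) (c *\<^sub>C x) = c * cnj (c * cinner x x)"
    by (metis cinner_commute cinner_scaleC_left)
  also have "\<dots> = (c * cnj c) * cinner x x"
    using cinner_commute[of x x] by simp
  also have "\<dots> = complex_of_real ((cmod c)\<^sup>2) * cinner x x"
    by (simp only: complex_norm_square)
  finally have "Re (cinner (c *\<^sub>C x) (c *\<^sub>C x)) = (cmod c)\<^sup>2 * Re (cinner x x)"
    by simp
  then show "norm (c *\<^sub>C x) \<le> norm x * cmod c"
    by (simp add: norm_eq_sqrt_cinner real_sqrt_mult)
qed

typedef (overloaded) ('a::complex_inner, 'b::complex_inner) cblinfun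
    (\<open>(_ \<Rightarrow>\<^sub>C\<^sub>L /_)\<close> [22, 21] 21) =
  "{f :: 'a \<Rightarrow> 'b. bounded_clinear f}"
  morphisms cblinfun_apply Cblinfun
proof (rule exI)
  have "c *\<^sub>C (0::'b) = 0" for c
    using bounded_linear_scaleC[of c, where 'a = 'b] by (rule linear_simps(3))
  then show "(\<lambda>_. 0) \<in> {f :: 'a \<Rightarrow> 'b. bounded_clinear f}"
    by (simp add: bounded_clinear_def bounded_linear_zero)
qed

setup_lifting type_definition_cblinfun

instantiation cblinfun :: (complex_inner, complex_inner) ab_group_add
begin

lift_definition zero_cblinfun :: "'a \<Rightarrow>\<^sub>C\<^sub>L 'b" is "\<lambda>_. 0"
proof -
  have "c *\<^sub>C (0::'b) = 0" for c
    using bounded_linear_scaleC[of c, where 'a = 'b] by (rule linear_simps(3))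
  then show "bounded_clinear (\<lambda>_::'a. 0::'b)"
    by (simp add: bounded_clinear_def bounded_linear_zero)
qed

lift_definition plus_cblinfun :: "'a \<Rightarrow>\<^sub>C\<^sub>L 'b \<Rightarrow> 'a \<Rightarrow>\<^sub>C\<^sub>L 'b \<Rightarrow> 'a \<Rightarrow>\<^sub>C\<^sub>L 'b" is "\<lambda>f g x. f x + g x"
  by (simp add: bounded_clinear_def bounded_linear_add scaleC_add_right)

lift_definition uminus_cblinfun :: "'a \<Rightarrow>\<^sub>C\<^sub>L 'b \<Rightarrow> 'a \<Rightarrow>\<^sub>C\<^sub>L 'b" is "\<lambda>f x. - f x"
  by (simp add: bounded_clinear_def bounded_linear_minus scaleC_uminus_right)

lift_definition minus_cblinfun :: "'a \<Rightarrow>\<^sub>C\<^sub>L 'b \<Rightarrow> 'a \<Rightarrow>\<^sub>C\<^sub>L 'b \<Rightarrow> 'a \<Rightarrow>\<^sub>C\<^sub>L 'b" is "\<lambda>f g x. f x - g x"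
  using bounded_linear_sub
  by (auto simp: bounded_clinear_def scaleC_add_right scaleC_uminus_right
      simp flip: add_uminus_conv_diff)

instance
  by (intro_classes; transfer) (auto simp: algebra_simps)

end

instantiation cblinfun :: (complex_inner, complex_inner) scaleC
begin

lift_definition scaleC_cblinfun :: "complex \<Rightarrow> 'a \<Rightarrow>\<^sub>C\<^sub>L 'b \<Rightarrow> 'a \<Rightarrow>\<^sub>C\<^sub>L 'b" is "\<lambda>c f x. c *\<^sub>C f x"
  by (auto simp: bounded_clinear_def scaleC_commute
      intro: bounded_linear_compose[OF bounded_linear_scaleC])

instance ..

end

lift_definition cblinfun_id :: "'a::complex_inner \<Rightarrow>\<^sub>C\<^sub>L 'a" is "\<lambda>x. x"
  by (simp add: bounded_clinear_def bounded_linear_ident)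

lift_definition cblinfun_compose ::
  "'b::complex_inner \<Rightarrow>\<^sub>C\<^sub>L 'c::complex_inner \<Rightarrow> 'a::complex_inner \<Rightarrow>\<^sub>C\<^sub>L 'b \<Rightarrow> 'a \<Rightarrow>\<^sub>C\<^sub>L 'c"
  (infixl \<open>o\<^sub>C\<^sub>L\<close> 67) is "\<lambda>f g x. f (g x)"
  by (simp add: bounded_clinear_def bounded_linear_compose)

definition commutator :: "'a::complex_inner \<Rightarrow>\<^sub>C\<^sub>L 'a \<Rightarrow> 'a \<Rightarrow>\<^sub>C\<^sub>L 'a \<Rightarrow> 'a \<Rightarrow>\<^sub>C\<^sub>L 'a" where
  "commutator S T = S o\<^sub>C\<^sub>L T - T o\<^sub>C\<^sub>L S"

definition invertible_cblinfun :: "'a::complex_inner \<Rightarrow>\<^sub>C\<^sub>L 'b::complex_inner \<Rightarrow> bool" where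
  "invertible_cblinfun T \<longleftrightarrow> (\<exists>S. S o\<^sub>C\<^sub>L T = cblinfun_id \<and> T o\<^sub>C\<^sub>L S = cblinfun_id)"

definition inv_cblinfun :: "'a::complex_inner \<Rightarrow>\<^sub>C\<^sub>L 'b::complex_inner \<Rightarrow> 'b \<Rightarrow>\<^sub>C\<^sub>L 'a" where
  "inv_cblinfun T = (THE S. S o\<^sub>C\<^sub>L T = cblinfun_id \<and> T o\<^sub>C\<^sub>L S = cblinfun_id)"

text \<open>The adjoint exists by the Riesz representation theorem (this is where completeness is
  needed) and is unique since the inner product is definite.\<close>

definition adj :: "'a::chilbert_space \<Rightarrow>\<^sub>C\<^sub>L 'b::chilbert_space \<Rightarrow> 'b \<Rightarrow>\<^sub>C\<^sub>L 'a" where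
  "adj T = (THE S. \<forall>x y. cinner (cblinfun_apply T x) y = cinner x (cblinfun_apply S y))"

definition selfadjoint :: "'a::chilbert_space \<Rightarrow>\<^sub>C\<^sub>L 'a \<Rightarrow> bool" where
  "selfadjoint T \<longleftrightarrow> adj T = T"

section \<open>Vessels and the VR conditions\<close>

text \<open>The families are indexed by the natural numbers, but only their values at indices in
  \<open>{1..d}\<close> belong to the vessel. The parameter \<open>\<gamma>s\<close> is \<open>\<gamma>\<^sub>*\<close>.\<close>

locale vessel =
  fixes d :: nat
    and \<Phi> :: "'h::chilbert_space \<Rightarrow>\<^sub>C\<^sub>L 'e::chilbert_space"
    and A :: "nat \<Rightarrow> 'h \<Rightarrow>\<^sub>C\<^sub>L 'h"
    and \<sigma> :: "nat \<Rightarrow> 'e \<Rightarrow>\<^sub>C\<^sub>L 'e"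
    and \<gamma> \<gamma>s :: "nat \<Rightarrow> nat \<Rightarrow> 'e \<Rightarrow>\<^sub>C\<^sub>L 'e"
  assumes d_pos: "1 \<le> d"
    and separable_inner_space: "separable_space (euclidean :: 'h topology)"
    and separable_outer_space: "separable_space (euclidean :: 'e topology)"
    and A_commute: "\<And>j k. j \<in> {1..d} \<Longrightarrow> k \<in> {1..d} \<Longrightarrow> A j o\<^sub>C\<^sub>L A k = A k o\<^sub>C\<^sub>L A j"
    and selfadjoint_\<sigma>: "\<And>j. j \<in> {1..d} \<Longrightarrow> selfadjoint (\<sigma> j)"
    and selfadjoint_\<gamma>: "\<And>j k. j \<in> {1..d} \<Longrightarrow> k \<in> {1..d} \<Longrightarrow> selfadjoint (\<gamma> j k)"
    and selfadjoint_\<gamma>s: "\<And>j k. j \<in> {1..d} \<Longrightarrow> k \<in> {1..d} \<Longrightarrow> selfadjoint (\<gamma>s j k)"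
    and colligation_relation: "\<And>k. k \<in> {1..d} \<Longrightarrow> A k - adj (A k) = \<i> *\<^sub>C (adj \<Phi> o\<^sub>C\<^sub>L \<sigma> k o\<^sub>C\<^sub>L \<Phi>)"
    and \<gamma>_antisym: "\<And>j k. j \<in> {1..d} \<Longrightarrow> k \<in> {1..d} \<Longrightarrow> \<gamma> j k = - \<gamma> k j"
    and \<gamma>s_antisym: "\<And>j k. j \<in> {1..d} \<Longrightarrow> k \<in> {1..d} \<Longrightarrow> \<gamma>s j k = - \<gamma>s k j"
    and input_relation: "\<And>j k. j \<in> {1..d} \<Longrightarrow> k \<in> {1..d} \<Longrightarrow>
      \<sigma> j o\<^sub>C\<^sub>L \<Phi> o\<^sub>C\<^sub>L adj (A k) - \<sigma> k o\<^sub>C\<^sub>L \<Phi> o\<^sub>C\<^sub>L adj (A j) = \<gamma> j k o\<^sub>C\<^sub>L \<Phi>"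
    and output_relation: "\<And>j k. j \<in> {1..d} \<Longrightarrow> k \<in> {1..d} \<Longrightarrow>
      \<sigma> j o\<^sub>C\<^sub>L \<Phi> o\<^sub>C\<^sub>L A k - \<sigma> k o\<^sub>C\<^sub>L \<Phi> o\<^sub>C\<^sub>L A j = \<gamma>s j k o\<^sub>C\<^sub>L \<Phi>"
    and linkage_relation: "\<And>j k. j \<in> {1..d} \<Longrightarrow> k \<in> {1..d} \<Longrightarrow>
      \<gamma>s j k - \<gamma> j k =
        \<i> *\<^sub>C (\<sigma> j o\<^sub>C\<^sub>L \<Phi> o\<^sub>C\<^sub>L adj \<Phi> o\<^sub>C\<^sub>L \<sigma> k - \<sigma> k o\<^sub>C\<^sub>L \<Phi> o\<^sub>C\<^sub>L adj \<Phi> o\<^sub>C\<^sub>L \<sigma> j)"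

text \<open>The conditions \<open>VR\<close> and \<open>VR\<^sub>*\<close> have the same shape; the former is
  \<open>VR_conditions d \<sigma> \<gamma>\<close>, the latter \<open>VR_conditions d \<sigma> \<gamma>s\<close>.\<close>

definition VR_conditions ::
  "nat \<Rightarrow> (nat \<Rightarrow> 'e::chilbert_space \<Rightarrow>\<^sub>C\<^sub>L 'e) \<Rightarrow> (nat \<Rightarrow> nat \<Rightarrow> 'e \<Rightarrow>\<^sub>C\<^sub>L 'e) \<Rightarrow> bool" where
  "VR_conditions d \<sigma> \<gamma> \<longleftrightarrow>
    (let S = inv_cblinfun (\<sigma> 1) in
      \<forall>j\<in>{2..d}. \<forall>k\<in>{2..d}.
        commutator (S o\<^sub>C\<^sub>L \<sigma> j) (S o\<^sub>C\<^sub>L \<sigma> k) = 0 \<and>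
        commutator (S o\<^sub>C\<^sub>L \<gamma> 1 j) (S o\<^sub>C\<^sub>L \<gamma> 1 k) = 0 \<and>
        commutator (S o\<^sub>C\<^sub>L \<sigma> k) (S o\<^sub>C\<^sub>L \<gamma> 1 j) = commutator (S o\<^sub>C\<^sub>L \<sigma> j) (S o\<^sub>C\<^sub>L \<gamma> 1 k) \<and>
        \<gamma> j k = \<sigma> j o\<^sub>C\<^sub>L S o\<^sub>C\<^sub>L \<gamma> 1 k - \<sigma> k o\<^sub>C\<^sub>L S o\<^sub>C\<^sub>L \<gamma> 1 j)"

end

theory Submission
  imports Defs
begin

text \<open>Write \<open>a\<^sub>j = \<sigma>\<^sub>1\<^sup>-\<^sup>1 \<sigma>\<^sub>j\<close>,
  \<open>g\<^sub>j = \<sigma>\<^sub>1\<^sup>-\<^sup>1 \<gamma>\<^sub>1\<^sub>j\<close>,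
  \<open>h\<^sub>j = \<sigma>\<^sub>1\<^sup>-\<^sup>1 \<gamma>\<^sub>*\<^sub>1\<^sub>j\<close> and
  \<open>P = \<i> \<Phi> \<Phi>\<^sup>* \<sigma>\<^sub>1\<close>. Linkage says \<open>h\<^sub>j = g\<^sub>j + [P, a\<^sub>j]\<close>, and the output relation
  together with the adjoint of the input relation gives
  \<open>P g\<^sub>j - h\<^sub>j P = [a\<^sub>j, Q]\<close> with \<open>Q = \<i> \<Phi> A\<^sub>1 \<Phi>\<^sup>* \<sigma>\<^sub>1\<close>. By the Jacobi identity
  these two facts carry the conditions on \<open>g\<close> over to \<open>h\<close>. The converse is the same argument
  with \<open>- P\<close> in place of \<open>P\<close> and \<open>A\<^sub>1\<^sup>*\<close> in place of \<open>A\<^sub>1\<close>.\<close>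

section \<open>Riesz representation and adjoints\<close>

lemma cinner_add_right: "cinner x (y + z) = cinner x y + cinner x (z::'a::complex_inner)"
  by (metis cinner_commute cinner_add_left complex_cnj_add)

lemma cinner_scaleC_right: "cinner x (c *\<^sub>C y) = cnj c * cinner x (y::'a::complex_inner)"
  by (metis cinner_commute cinner_scaleC_left complex_cnj_mult)

lemma scaleC_minus_one: "(- 1) *\<^sub>C x = - (x::'a::complex_inner)"
  using scaleR_scaleC[of "- 1" x] by simp

lemma cinner_minus_left: "cinner (- x) y = - cinner x (y::'a::complex_inner)"
  using cinner_scaleC_left[of "- 1" x y] by (simp add: scaleC_minus_one)

lemma cinner_diff_left: "cinner (x - y) z = cinner x z - cinner y (z::'a::complex_inner)"
  using cinner_add_left[of x "- y" z] by (simp add: cinner_minus_left)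

lemma cinner_diff_right: "cinner x (y - z) = cinner x y - cinner x (z::'a::complex_inner)"
  by (metis cinner_commute cinner_diff_left complex_cnj_diff)

lemma Re_cinner_commute: "Re (cinner x y) = Re (cinner y (x::'a::complex_inner))"
  by (subst cinner_commute) simp

lemma Re_cinner_scaleR_left: "Re (cinner (r *\<^sub>R x) y) = r * Re (cinner x (y::'a::complex_inner))"
  by (simp add: scaleR_scaleC cinner_scaleC_left)

lemma Re_cinner_scaleR_right: "Re (cinner x (r *\<^sub>R y)) = r * Re (cinner x (y::'a::complex_inner))"
  by (simp add: scaleR_scaleC cinner_scaleC_right)

lemma Re_cinner_self: "Re (cinner x x) = (norm (x::'a::complex_inner))\<^sup>2"
proof -
  have "0 \<le> sqrt (Re (cinner x x))"
    using norm_ge_zero[of x] by (simp only: norm_eq_sqrt_cinner)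
  then show ?thesis
    by (simp add: norm_eq_sqrt_cinner)
qed

lemma power2_norm_add:
  "(norm (x + y))\<^sup>2 = (norm x)\<^sup>2 + 2 * Re (cinner x y) + (norm (y::'a::complex_inner))\<^sup>2"
  by (simp add: Re_cinner_commute[of y x] cinner_add_left cinner_add_right flip: Re_cinner_self)

lemma power2_norm_diff:
  "(norm (x - y))\<^sup>2 = (norm x)\<^sup>2 - 2 * Re (cinner x y) + (norm (y::'a::complex_inner))\<^sup>2"
  by (simp add: Re_cinner_commute[of y x] cinner_diff_left cinner_diff_right flip: Re_cinner_self)

text \<open>Expand the squared norm of \<open>norm y *\<^sub>R x - norm x *\<^sub>R y\<close> and
  divide by \<open>2 * (norm x * norm y)\<close>.\<close>

lemma Re_cinner_le_norm: "Re (cinner x y) \<le> norm x * norm (y::'a::complex_inner)"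
proof (cases "x = 0 \<or> y = 0")
  case True
  then show ?thesis
    using Re_cinner_scaleR_left[of 0 x y] Re_cinner_scaleR_right[of x 0 y] by auto
next
  case False
  have "0 \<le> (norm (norm y *\<^sub>R x - norm x *\<^sub>R y))\<^sup>2"
    by simp
  also have "\<dots> = 2 * (norm x * norm y) * (norm x * norm y - Re (cinner x y))"
    unfolding power2_norm_diff
    by (simp add: Re_cinner_scaleR_left Re_cinner_scaleR_right algebra_simps power2_eq_square)
  finally have "0 \<le> 2 * (norm x * norm y) * (norm x * norm y - Re (cinner x y))" .
  moreover have "0 < 2 * (norm x * norm y)"
    using False by simp
  ultimately have "0 \<le> norm x * norm y - Re (cinner x y)"
    by (simp only: zero_le_mult_iff) linarith
  then show ?thesis
    by simp
qed

lemma bounded_linear_Re_cinner: "bounded_linear (\<lambda>x. Re (cinner x (y::'a::complex_inner)))"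
proof (rule bounded_linear_intro[where K = "norm y"])
  fix x :: 'a
  show "norm (Re (cinner x y)) \<le> norm x * norm y"
    using Re_cinner_le_norm[of x y] Re_cinner_le_norm[of "- x" y]
    by (simp add: cinner_minus_left)
qed (simp_all add: cinner_add_left Re_cinner_scaleR_left)

text \<open>The representing vector minimizes \<open>\<parallel>x\<parallel>\<^sup>2 - 2 f x\<close>; minimizing sequences are Cauchy by the
  parallelogram law.\<close>

lemma Riesz_representation:
  fixes f :: "'a::chilbert_space \<Rightarrow> real"
  assumes "bounded_linear f"
  shows "\<exists>u. \<forall>x. Re (cinner x u) = f x"
proof -
  interpret f: bounded_linear f by fact
  define J where "J x = (norm x)\<^sup>2 - 2 * f x" for x
  obtain K where K: "\<And>x. norm (f x) \<le> norm x * K"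
    using f.bounded by blast
  \<comment> \<open>Completing the square: \<open>J x\<close> is at least
    \<open>(norm x - K)\<^sup>2 - K\<^sup>2\<close>.\<close>
  have "- K\<^sup>2 \<le> J x" for x
  proof -
    have "0 \<le> (norm x - K)\<^sup>2"
      by simp
    then show ?thesis
      using K[of x] by (simp add: J_def power2_diff)
  qed
  then have bdd: "bdd_below (range J)"
    by (auto intro!: bdd_belowI[where m = "- K\<^sup>2"])
  define m where "m = (INF x. J x)"
  have m_le: "m \<le> J x" for x
    unfolding m_def by (rule cINF_lower[OF bdd]) simp
  have "\<exists>x. J x < m + inverse (real (Suc n))" for n
  proof -
    have "(INF x. J x) < m + inverse (real (Suc n))"
      by (simp add: m_def)
    then show ?thesis
      using cINF_less_iff[OF _ bdd] by auto
  qed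
  then obtain X where X: "\<And>n. J (X n) < m + inverse (real (Suc n))"
    by metis
  \<comment> \<open>The parallelogram law turns the left side into \<open>2 * J x + 2 * J y\<close>
    minus four times \<open>J\<close> at the midpoint, where \<open>J\<close> is at least
    \<open>m\<close>.\<close>
  have parallelogram: "(norm (x - y))\<^sup>2 \<le> 2 * J x + 2 * J y - 4 * m" for x y
  proof -
    have "4 * J ((1/2) *\<^sub>R z) = (norm z)\<^sup>2 - 4 * f z" for z
      by (simp add: J_def f.scaleR power_divide)
    from this[of "x + y"] have "4 * J ((1/2) *\<^sub>R (x + y)) = (norm (x + y))\<^sup>2 - 4 * f x - 4 * f y"
      by (simp add: f.add)
    then show ?thesis
      using m_le[of "(1/2) *\<^sub>R (x + y)"] by (simp add: J_def power2_norm_diff power2_norm_add)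
  qed
  have "Cauchy X"
  proof (rule metric_CauchyI)
    fix e :: real
    assume "0 < e"
    \<comment> \<open>Two excesses over \<open>m\<close>, each below \<open>e\<^sup>2 / 4\<close>
      and each doubled by the parallelogram bound, add up to less than
      \<open>e\<^sup>2\<close>.\<close>
    then obtain N where N: "inverse (real (Suc N)) < e\<^sup>2 / 4"
      using reals_Archimedean[of "e\<^sup>2 / 4"] by auto
    have "dist (X i) (X j) < e" if "N \<le> i" "N \<le> j" for i j
    proof -
      have "inverse (real (Suc i)) \<le> inverse (real (Suc N))"
        "inverse (real (Suc j)) \<le> inverse (real (Suc N))"
        using that by (auto intro: le_imp_inverse_le)
      then have "(norm (X i - X j))\<^sup>2 < e\<^sup>2"
        using parallelogram[of "X i" "X j"] X[of i] X[of j] N by linarith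
      then show ?thesis
        using \<open>0 < e\<close> by (simp add: dist_norm power2_less_imp_less)
    qed
    then show "\<exists>N. \<forall>i\<ge>N. \<forall>j\<ge>N. dist (X i) (X j) < e"
      by blast
  qed
  then obtain u where u: "X \<longlonglongrightarrow> u"
    using Cauchy_convergent_iff convergent_def by blast
  have "(\<lambda>n. J (X n)) \<longlonglongrightarrow> J u"
    unfolding J_def by (intro tendsto_intros u f.tendsto)
  moreover have "(\<lambda>n. m + inverse (real (Suc n))) \<longlonglongrightarrow> m + 0"
    by (intro tendsto_intros LIMSEQ_inverse_real_of_nat)
  ultimately have "J u \<le> m + 0"
    by (rule LIMSEQ_le) (use X less_imp_le in blast)
  then have "J u \<le> m"
    by simp
  have "Re (cinner x u) = f x" for x
  proof -
    \<comment> \<open>Half the derivative of \<open>J\<close> at the minimizer \<open>u\<close> in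
      direction \<open>x\<close>; it has to vanish.\<close>
    define b where "b = Re (cinner x u) - f x"
    have quadratic: "0 \<le> t\<^sup>2 * (norm x)\<^sup>2 + 2 * t * b" for t
    proof -
      have "J (u + t *\<^sub>R x) = J u + (t\<^sup>2 * (norm x)\<^sup>2 + 2 * t * b)"
        by (simp add: J_def b_def power2_norm_add f.add f.scaleR Re_cinner_scaleR_right
            Re_cinner_commute[of u x] power_mult_distrib algebra_simps)
      then show ?thesis
        using m_le[of "u + t *\<^sub>R x"] \<open>J u \<le> m\<close> by linarith
    qed
    \<comment> \<open>The \<open>+ 1\<close> keeps \<open>s\<close> positive at
      \<open>x = 0\<close>. With \<open>t = - b / s\<close> the negative linear term outweighs the
      quadratic one unless \<open>b = 0\<close>.\<close>
    define s where "s = (norm x)\<^sup>2 + 1"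
    have "s > 0"
      by (simp add: s_def add_nonneg_pos)
    have "0 \<le> s\<^sup>2 * ((- b / s)\<^sup>2 * (norm x)\<^sup>2 + 2 * (- b / s) * b)"
      using quadratic[of "- b / s"] by simp
    also have "\<dots> = b\<^sup>2 * (norm x)\<^sup>2 - 2 * b\<^sup>2 * s"
      using \<open>s > 0\<close> by (simp add: field_simps power2_eq_square)
    also have "\<dots> = - (b\<^sup>2 * ((norm x)\<^sup>2 + 2))"
      by (simp add: s_def algebra_simps)
    finally have "b\<^sup>2 * ((norm x)\<^sup>2 + 2) \<le> 0"
      by simp
    moreover have "(norm x)\<^sup>2 + 2 > 0"
      by (simp add: add_nonneg_pos)
    ultimately have "b = 0"
      by (simp add: mult_le_0_iff)
    then show ?thesis
      by (simp add: b_def)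
  qed
  then show ?thesis
    by blast
qed

section \<open>Existence and uniqueness of adjoints\<close>

text \<open>The imaginary part of \<open>f x\<close> is minus the real part of
  \<open>f (\<i> *\<^sub>C x)\<close>. This lifts the real Riesz representation to the complex inner
  product.\<close>

lemma complex_linear_eq_if_Re_eq:
  fixes f g :: "'a::complex_inner \<Rightarrow> complex"
  assumes "\<And>x. f (\<i> *\<^sub>C x) = \<i> * f x" "\<And>x. g (\<i> *\<^sub>C x) = \<i> * g x" "\<And>x. Re (f x) = Re (g x)"
  shows "f x = g x"
  using assms(3)[of x] assms(3)[of "\<i> *\<^sub>C x"] by (simp add: assms(1,2) complex_eq_iff)

lemma cinner_ext:
  assumes "\<And>x. cinner x y = cinner x (z::'a::complex_inner)"
  shows "y = z"
proof -
  have "(norm (y - z))\<^sup>2 = 0"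
    using assms[of "y - z"] by (simp add: cinner_diff_right flip: Re_cinner_self)
  then show ?thesis
    by simp
qed

lemma bounded_clinear_cblinfun_apply: "bounded_clinear (cblinfun_apply T)"
  using cblinfun_apply by blast

lemma cblinfun_apply_scaleC: "cblinfun_apply T (c *\<^sub>C x) = c *\<^sub>C cblinfun_apply T x"
  using bounded_clinear_cblinfun_apply[of T] by (simp add: bounded_clinear_def)

lemma bounded_linear_cblinfun_apply: "bounded_linear (cblinfun_apply T)"
  using bounded_clinear_cblinfun_apply[of T] by (simp add: bounded_clinear_def)

text \<open>For each \<open>y\<close> the Riesz vector of the functional sending \<open>x\<close> to
  \<open>Re (cinner (cblinfun_apply T x) y)\<close> is taken as \<open>s y\<close>. Linearity of
  \<open>s\<close> follows by pairing with arbitrary vectors.\<close>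

lemma adjoint_exists:
  fixes T :: "'a::chilbert_space \<Rightarrow>\<^sub>C\<^sub>L 'b::chilbert_space"
  shows "\<exists>S. \<forall>x y. cinner (cblinfun_apply T x) y = cinner x (cblinfun_apply S y)"
proof -
  have "\<exists>u. \<forall>x. cinner (cblinfun_apply T x) y = cinner x u" for y
  proof -
    obtain u where u: "\<And>x. Re (cinner x u) = Re (cinner (cblinfun_apply T x) y)"
      using Riesz_representation[OF bounded_linear_compose[OF bounded_linear_Re_cinner
          bounded_linear_cblinfun_apply]] by blast
    have "cinner (cblinfun_apply T x) y = cinner x u" for x
      by (rule complex_linear_eq_if_Re_eq)
        (simp_all add: u cinner_scaleC_left cblinfun_apply_scaleC)
    then show ?thesis
      by blast
  qed
  then obtain s where s: "\<And>x y. cinner (cblinfun_apply T x) y = cinner x (s y)"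
    by metis
  obtain K where "0 \<le> K" and K: "\<And>x. norm (cblinfun_apply T x) \<le> norm x * K"
    using bounded_linear.nonneg_bounded[OF bounded_linear_cblinfun_apply] by blast
  have scaleC: "s (c *\<^sub>C y) = c *\<^sub>C s y" for c y
    by (rule cinner_ext) (simp add: cinner_scaleC_right flip: s)
  have "bounded_linear s"
  proof (rule bounded_linear_intro[where K = K])
    show "s (y + z) = s y + s z" for y z
      by (rule cinner_ext) (simp add: cinner_add_right flip: s)
    show "s (r *\<^sub>R y) = r *\<^sub>R s y" for r y
      by (simp add: scaleR_scaleC scaleC)
    show "norm (s y) \<le> norm y * K" for y
    proof (cases "s y = 0")
      case True
      then show ?thesis
        using \<open>0 \<le> K\<close> by simp
    next
      case False
      \<comment> \<open>Testing the defining identity at \<open>x = s y\<close> shows that the bound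
        \<open>K\<close> of \<open>T\<close> also bounds \<open>s\<close>.\<close>
      have "norm (s y) * norm (s y) = Re (cinner (cblinfun_apply T (s y)) y)"
        by (simp add: s Re_cinner_self power2_eq_square)
      also have "\<dots> \<le> norm (cblinfun_apply T (s y)) * norm y"
        by (rule Re_cinner_le_norm)
      also have "\<dots> \<le> (norm (s y) * K) * norm y"
        by (intro mult_right_mono K) simp
      finally have "norm (s y) * norm (s y) \<le> norm (s y) * (norm y * K)"
        by (simp add: algebra_simps)
      then show ?thesis
        using False by simp
    qed
  qed
  then have "bounded_clinear s"
    by (simp add: bounded_clinear_def scaleC)
  then show ?thesis
    using s by (intro exI[of _ "Cblinfun s"]) (simp add: Cblinfun_inverse)
qed

lemma cblinfun_eqI: "(\<And>x. cblinfun_apply S x = cblinfun_apply T x) \<Longrightarrow> S = T"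
  by (auto simp flip: cblinfun_apply_inject)

lemma cinner_cblinfun_apply:
  "cinner (cblinfun_apply T x) y = cinner x (cblinfun_apply (adj T) y)"
proof -
  have "\<exists>!S. \<forall>x y. cinner (cblinfun_apply T x) y = cinner x (cblinfun_apply S y)"
    using adjoint_exists[of T] by (metis cblinfun_eqI cinner_ext)
  from theI'[OF this] show ?thesis
    unfolding adj_def by blast
qed

lemma adj_eqI:
  assumes "\<And>x y. cinner (cblinfun_apply T x) y = cinner x (cblinfun_apply S y)"
  shows "adj T = S"
  by (metis assms cblinfun_eqI cinner_cblinfun_apply cinner_ext)

lemma adj_compose: "adj (S o\<^sub>C\<^sub>L T) = adj T o\<^sub>C\<^sub>L adj S"
  by (rule adj_eqI) (simp add: cblinfun_compose.rep_eq cinner_cblinfun_apply)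

lemma adj_diff: "adj (S - T) = adj S - adj T"
  by (rule adj_eqI)
    (simp add: minus_cblinfun.rep_eq cinner_diff_left cinner_diff_right cinner_cblinfun_apply)

lemma adj_adj: "adj (adj T) = T"
  by (rule adj_eqI) (metis cinner_cblinfun_apply cinner_commute)

section \<open>Algebra of bounded operators\<close>

lemma cblinfun_compose_assoc: "(R o\<^sub>C\<^sub>L S) o\<^sub>C\<^sub>L T = R o\<^sub>C\<^sub>L (S o\<^sub>C\<^sub>L T)"
  by transfer simp

lemma cblinfun_compose_id [simp]: "cblinfun_id o\<^sub>C\<^sub>L T = T" "T o\<^sub>C\<^sub>L cblinfun_id = T"
  by (transfer, simp)+

lemma cblinfun_compose_add_left: "(R + S) o\<^sub>C\<^sub>L T = R o\<^sub>C\<^sub>L T + S o\<^sub>C\<^sub>L T"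
  by transfer simp

lemma cblinfun_compose_add_right: "R o\<^sub>C\<^sub>L (S + T) = R o\<^sub>C\<^sub>L S + R o\<^sub>C\<^sub>L T"
  by transfer (simp add: bounded_clinear_def linear_simps)

lemma cblinfun_compose_diff_left: "(R - S) o\<^sub>C\<^sub>L T = R o\<^sub>C\<^sub>L T - S o\<^sub>C\<^sub>L T"
  by transfer simp

lemma cblinfun_compose_diff_right: "R o\<^sub>C\<^sub>L (S - T) = R o\<^sub>C\<^sub>L S - R o\<^sub>C\<^sub>L T"
  by transfer (simp add: bounded_clinear_def linear_simps)

lemma cblinfun_compose_scaleC_left: "(c *\<^sub>C S) o\<^sub>C\<^sub>L T = c *\<^sub>C (S o\<^sub>C\<^sub>L T)"
  by transfer simp

lemma cblinfun_compose_scaleC_right: "S o\<^sub>C\<^sub>L (c *\<^sub>C T) = c *\<^sub>C (S o\<^sub>C\<^sub>L T)"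
  by transfer (simp add: bounded_clinear_def)

lemma cblinfun_scaleC_diff_right: "c *\<^sub>C (S - T) = c *\<^sub>C S - c *\<^sub>C T"
  for S T :: "'a::complex_inner \<Rightarrow>\<^sub>C\<^sub>L 'b::complex_inner"
  by transfer (simp add: linear_simps[OF bounded_linear_scaleC])

text \<open>Lets the purely algebraic commutator lemma below be applied to operators on one space,
  with composition as product.\<close>

interpretation cblinfun: ring where times = "(o\<^sub>C\<^sub>L)" and plus = "(+)"
    and zero = "0 :: 'a::complex_inner \<Rightarrow>\<^sub>C\<^sub>L 'a"
    and minus = "(-)" and uminus = uminus
  by unfold_locales
    (simp_all add: cblinfun_compose_assoc cblinfun_compose_add_left cblinfun_compose_add_right)

lemma inv_cblinfun:
  assumes "invertible_cblinfun T"
  shows "inv_cblinfun T o\<^sub>C\<^sub>L T = cblinfun_id" "T o\<^sub>C\<^sub>L inv_cblinfun T = cblinfun_id"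
proof -
  have "\<exists>!S. S o\<^sub>C\<^sub>L T = cblinfun_id \<and> T o\<^sub>C\<^sub>L S = cblinfun_id"
    using assms unfolding invertible_cblinfun_def
    by (metis cblinfun_compose_assoc cblinfun_compose_id)
  from theI'[OF this]
  show "inv_cblinfun T o\<^sub>C\<^sub>L T = cblinfun_id" "T o\<^sub>C\<^sub>L inv_cblinfun T = cblinfun_id"
    unfolding inv_cblinfun_def by blast+
qed

section \<open>Transfer of the VR conditions\<close>

text \<open>Expanding \<open>[g + [p,a], h + [p,b]]\<close> leaves double commutators. Jacobi
  regroups them so that \<open>abgh\<close>, \<open>pg\<close> and \<open>ph\<close> apply; what
  then remains vanishes because \<open>a\<close> and \<open>b\<close> commute.\<close>

lemma (in ring) commute_perturbation:
  assumes ab: "b * a = a * b"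
    and gh: "g * h = h * g"
    and abgh: "b * g - g * b = a * h - h * a"
    and g': "g' = g + (p * a - a * p)"
    and h': "h' = h + (p * b - b * p)"
    and pg: "p * g - g' * p = a * q - q * a"
    and ph: "p * h - h' * p = b * q - q * b"
  shows "g' * h' = h' * g'"
proof -
  have ab': "b * (a * x) = a * (b * x)" for x
    using ab by (metis mult_assoc)
  \<comment> \<open>\<open>D\<close> and \<open>E\<close> are the commutators of \<open>g\<close>
    and \<open>h\<close> with \<open>p\<close>, and \<open>G\<close> is the defect in
    \<open>abgh\<close>. Naming them lets the expansion be grouped before the hypotheses are
    substituted.\<close>
  define D where "D = g * p - p * g"
  define E where "E = h * p - p * h"
  define G where "G = (b * g - g * b) - (a * h - h * a)"
  have D: "D = - ((p * a - a * p) * p + (a * q - q * a))"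
    unfolding D_def pg[symmetric] g' by (simp add: algebra_simps)
  have E: "E = - ((p * b - b * p) * p + (b * q - q * b))"
    unfolding E_def ph[symmetric] h' by (simp add: algebra_simps)
  have G: "G = 0"
    by (simp add: G_def abgh)
  \<comment> \<open>Free ring identity: \<open>[g,[p,b]] = [D,b] + [p,[g,b]]\<close> and
    \<open>[[p,a],h] = - [E,a] - [p,[h,a]]\<close>, and the two outer terms combine to
    \<open>[G,p]\<close>.\<close>
  have "g' * h' - h' * g' = (g * h - h * g) + (D * b - b * D) - (E * a - a * E) + (G * p - p * G)
      + ((p * a - a * p) * (p * b - b * p) - (p * b - b * p) * (p * a - a * p))"
    unfolding g' h' D_def E_def G_def by (simp add: algebra_simps)
  also have "\<dots> = 0"
    unfolding D E G gh by (simp add: algebra_simps ab ab')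
  finally show ?thesis
    by simp
qed

text \<open>Abstracts what both directions share: \<open>W\<close> stands for
  \<open>\<Phi> o\<^sub>C\<^sub>L adj \<Phi>\<close> times \<open>\<i>\<close> or
  \<open>- \<i>\<close>. Multiplying by the inverse of \<open>\<sigma> 1\<close> from the left
  reduces everything to commutators of \<open>a\<close>, \<open>g\<close>, \<open>P\<close> and
  \<open>Q\<close>.\<close>

lemma VR_conditions_perturbation:
  fixes \<sigma> :: "nat \<Rightarrow> 'e::chilbert_space \<Rightarrow>\<^sub>C\<^sub>L 'e"
  assumes inv: "invertible_cblinfun (\<sigma> 1)"
    and linkage: "\<And>j k. j \<in> {1..d} \<Longrightarrow> k \<in> {1..d} \<Longrightarrow>
      \<gamma>' j k - \<gamma> j k = \<sigma> j o\<^sub>C\<^sub>L W o\<^sub>C\<^sub>L \<sigma> k - \<sigma> k o\<^sub>C\<^sub>L W o\<^sub>C\<^sub>L \<sigma> j"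
    and intertwining: "\<And>k. k \<in> {1..d} \<Longrightarrow>
      \<sigma> 1 o\<^sub>C\<^sub>L W o\<^sub>C\<^sub>L \<gamma> 1 k - \<gamma>' 1 k o\<^sub>C\<^sub>L W o\<^sub>C\<^sub>L \<sigma> 1 = \<sigma> k o\<^sub>C\<^sub>L Q - \<sigma> 1 o\<^sub>C\<^sub>L Q o\<^sub>C\<^sub>L inv_cblinfun (\<sigma> 1) o\<^sub>C\<^sub>L \<sigma> k"
    and VR: "VR_conditions d \<sigma> \<gamma>"
  shows "VR_conditions d \<sigma> \<gamma>'"
proof -
  define S where "S = inv_cblinfun (\<sigma> 1)"
  define P where "P = W o\<^sub>C\<^sub>L \<sigma> 1"
  define a where "a j = S o\<^sub>C\<^sub>L \<sigma> j" for j
  define g where "g j = S o\<^sub>C\<^sub>L \<gamma> 1 j" for j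
  define g' where "g' j = S o\<^sub>C\<^sub>L \<gamma>' 1 j" for j
  note assoc = cblinfun_compose_assoc
  note distribs = cblinfun_compose_add_left cblinfun_compose_add_right
    cblinfun_compose_diff_left cblinfun_compose_diff_right
  \<comment> \<open>Otherwise the simplifier turns the index \<open>1\<close> into
    \<open>Suc 0\<close>, and facts about \<open>\<sigma> 1\<close> no longer match.\<close>
  note One_nat_def [simp del]
  have S: "S o\<^sub>C\<^sub>L \<sigma> 1 = cblinfun_id" "\<sigma> 1 o\<^sub>C\<^sub>L S = cblinfun_id"
    using inv_cblinfun[OF inv] by (simp_all add: S_def)
  have S': "S o\<^sub>C\<^sub>L (\<sigma> 1 o\<^sub>C\<^sub>L X) = X" "\<sigma> 1 o\<^sub>C\<^sub>L (S o\<^sub>C\<^sub>L X) = X" for X :: "'e \<Rightarrow>\<^sub>C\<^sub>L 'e"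
    by (simp_all only: S cblinfun_compose_id flip: assoc)
  have linkage': "S o\<^sub>C\<^sub>L \<gamma>' j k = S o\<^sub>C\<^sub>L \<gamma> j k + (a j o\<^sub>C\<^sub>L P o\<^sub>C\<^sub>L a k - a k o\<^sub>C\<^sub>L P o\<^sub>C\<^sub>L a j)"
    if "j \<in> {1..d}" "k \<in> {1..d}" for j k
  proof -
    have "S o\<^sub>C\<^sub>L \<gamma>' j k - S o\<^sub>C\<^sub>L \<gamma> j k = S o\<^sub>C\<^sub>L (\<sigma> j o\<^sub>C\<^sub>L W o\<^sub>C\<^sub>L \<sigma> k - \<sigma> k o\<^sub>C\<^sub>L W o\<^sub>C\<^sub>L \<sigma> j)"
      using linkage[OF that] by (metis cblinfun_compose_diff_right)
    also have "\<dots> = a j o\<^sub>C\<^sub>L P o\<^sub>C\<^sub>L a k - a k o\<^sub>C\<^sub>L P o\<^sub>C\<^sub>L a j"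
      by (simp add: cblinfun_compose_diff_right assoc a_def P_def S')
    finally show ?thesis
      by (simp add: algebra_simps)
  qed
  \<comment> \<open>The case \<open>j = 1\<close> of linkage, where \<open>a 1\<close> is the
    identity.\<close>
  have g': "g' k = g k + (P o\<^sub>C\<^sub>L a k - a k o\<^sub>C\<^sub>L P)" if "k \<in> {1..d}" for k
    using that linkage'[of 1 k] by (simp add: g'_def g_def a_def S)
  have Pg: "P o\<^sub>C\<^sub>L g k - g' k o\<^sub>C\<^sub>L P = a k o\<^sub>C\<^sub>L Q - Q o\<^sub>C\<^sub>L a k" if "k \<in> {1..d}" for k
  proof -
    have "P o\<^sub>C\<^sub>L g k - g' k o\<^sub>C\<^sub>L P = S o\<^sub>C\<^sub>L (\<sigma> 1 o\<^sub>C\<^sub>L W o\<^sub>C\<^sub>L \<gamma> 1 k - \<gamma>' 1 k o\<^sub>C\<^sub>L W o\<^sub>C\<^sub>L \<sigma> 1)"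
      by (simp add: cblinfun_compose_diff_right assoc g_def g'_def P_def S')
    also have "\<dots> = a k o\<^sub>C\<^sub>L Q - Q o\<^sub>C\<^sub>L a k"
      unfolding intertwining[OF that] S_def[symmetric]
      by (simp add: cblinfun_compose_diff_right assoc a_def S')
    finally show ?thesis .
  qed
  show ?thesis
    unfolding VR_conditions_def Let_def S_def[symmetric]
      a_def[symmetric] g'_def[symmetric] commutator_def
  proof (intro ballI conjI)
    fix j k
    assume jk: "j \<in> {2..d}" "k \<in> {2..d}"
    then have jk': "j \<in> {1..d}" "k \<in> {1..d}"
      by auto
    have aa: "a k o\<^sub>C\<^sub>L a j = a j o\<^sub>C\<^sub>L a k"
      and gg: "g j o\<^sub>C\<^sub>L g k = g k o\<^sub>C\<^sub>L g j"
      and ag: "a k o\<^sub>C\<^sub>L g j - g j o\<^sub>C\<^sub>L a k = a j o\<^sub>C\<^sub>L g k - g k o\<^sub>C\<^sub>L a j"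
      and \<gamma>: "\<gamma> j k = \<sigma> j o\<^sub>C\<^sub>L S o\<^sub>C\<^sub>L \<gamma> 1 k - \<sigma> k o\<^sub>C\<^sub>L S o\<^sub>C\<^sub>L \<gamma> 1 j"
      using VR jk unfolding VR_conditions_def Let_def S_def[symmetric]
        a_def[symmetric] g_def[symmetric] commutator_def by auto
    have aa': "a k o\<^sub>C\<^sub>L (a j o\<^sub>C\<^sub>L X) = a j o\<^sub>C\<^sub>L (a k o\<^sub>C\<^sub>L X)" for X :: "'e \<Rightarrow>\<^sub>C\<^sub>L 'e"
      using aa by (metis assoc)
    show "a j o\<^sub>C\<^sub>L a k - a k o\<^sub>C\<^sub>L a j = 0"
      by (simp add: aa)
    show "g' j o\<^sub>C\<^sub>L g' k - g' k o\<^sub>C\<^sub>L g' j = 0"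
      using cblinfun.commute_perturbation[OF aa gg ag g'[OF jk'(1)] g'[OF jk'(2)]
          Pg[OF jk'(1)] Pg[OF jk'(2)]] by simp
    \<comment> \<open>The perturbation cancels: \<open>[a k, [P, a j]] = [a j, [P, a k]]\<close> by
      Jacobi, since \<open>a j\<close> and \<open>a k\<close> commute.\<close>
    have "(a k o\<^sub>C\<^sub>L g' j - g' j o\<^sub>C\<^sub>L a k) - (a j o\<^sub>C\<^sub>L g' k - g' k o\<^sub>C\<^sub>L a j)
        = (a k o\<^sub>C\<^sub>L g j - g j o\<^sub>C\<^sub>L a k) - (a j o\<^sub>C\<^sub>L g k - g k o\<^sub>C\<^sub>L a j)"
      unfolding g'[OF jk'(1)] g'[OF jk'(2)] by (simp add: distribs assoc aa aa')
    then show "a k o\<^sub>C\<^sub>L g' j - g' j o\<^sub>C\<^sub>L a k = a j o\<^sub>C\<^sub>L g' k - g' k o\<^sub>C\<^sub>L a j"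
      by (simp add: ag)
    have "S o\<^sub>C\<^sub>L \<gamma> j k = a j o\<^sub>C\<^sub>L g k - a k o\<^sub>C\<^sub>L g j"
      by (simp add: \<gamma> a_def g_def assoc cblinfun_compose_diff_right)
    \<comment> \<open>In \<open>a j [P, a k] - a k [P, a j]\<close> the terms ending in
      \<open>P\<close> cancel, which leaves exactly the linkage correction.\<close>
    then have "S o\<^sub>C\<^sub>L \<gamma>' j k = a j o\<^sub>C\<^sub>L g' k - a k o\<^sub>C\<^sub>L g' j"
      unfolding linkage'[OF jk'] g'[OF jk'(1)] g'[OF jk'(2)]
      by (simp add: distribs assoc aa aa')
    then have "\<gamma>' j k = \<sigma> 1 o\<^sub>C\<^sub>L (a j o\<^sub>C\<^sub>L g' k - a k o\<^sub>C\<^sub>L g' j)"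
      by (metis S'(2))
    then show "\<gamma>' j k = \<sigma> j o\<^sub>C\<^sub>L S o\<^sub>C\<^sub>L \<gamma>' 1 k - \<sigma> k o\<^sub>C\<^sub>L S o\<^sub>C\<^sub>L \<gamma>' 1 j"
      by (simp add: a_def g'_def assoc cblinfun_compose_diff_right S')
  qed
qed

section \<open>Linkage and intertwining for a vessel\<close>

context vessel
begin

text \<open>Adjoints reverse the products, so \<open>adj \<Phi>\<close> now stands to the left of
  \<open>\<gamma> j k\<close> and can meet a factor \<open>\<Phi>\<close> in front of it.\<close>

lemma adjoint_input_relation:
  assumes "j \<in> {1..d}" "k \<in> {1..d}"
  shows "A k o\<^sub>C\<^sub>L adj \<Phi> o\<^sub>C\<^sub>L \<sigma> j - A j o\<^sub>C\<^sub>L adj \<Phi> o\<^sub>C\<^sub>L \<sigma> k = adj \<Phi> o\<^sub>C\<^sub>L \<gamma> j k"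
  using arg_cong[OF input_relation[OF assms], of adj]
    selfadjoint_\<sigma>[OF assms(1)] selfadjoint_\<sigma>[OF assms(2)] selfadjoint_\<gamma>[OF assms]
  by (simp add: adj_diff adj_compose adj_adj selfadjoint_def cblinfun_compose_assoc)

lemma adjoint_output_relation:
  assumes "j \<in> {1..d}" "k \<in> {1..d}"
  shows "adj (A k) o\<^sub>C\<^sub>L adj \<Phi> o\<^sub>C\<^sub>L \<sigma> j - adj (A j) o\<^sub>C\<^sub>L adj \<Phi> o\<^sub>C\<^sub>L \<sigma> k = adj \<Phi> o\<^sub>C\<^sub>L \<gamma>s j k"
  using arg_cong[OF output_relation[OF assms], of adj]
    selfadjoint_\<sigma>[OF assms(1)] selfadjoint_\<sigma>[OF assms(2)] selfadjoint_\<gamma>s[OF assms]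
  by (simp add: adj_diff adj_compose selfadjoint_def cblinfun_compose_assoc)

end

text \<open>Substituting \<open>right\<close> behind \<open>\<Phi>\<close> and \<open>left\<close>
  before \<open>\<Psi>\<close> produces
  \<open>\<sigma>\<^sub>1 \<Phi> B \<Psi> \<sigma>\<^sub>1\<close> twice with opposite signs, so
  only \<open>B\<^sub>1\<close> survives. Inserting \<open>inv_cblinfun \<sigma>\<^sub>1\<close>
  makes both remaining terms contain the same middle operator.\<close>

lemma intertwining_of_relations:
  fixes \<Phi> :: "'h::complex_inner \<Rightarrow>\<^sub>C\<^sub>L 'e::complex_inner" and \<Psi> :: "'e \<Rightarrow>\<^sub>C\<^sub>L 'h"
  assumes inv: "invertible_cblinfun \<sigma>\<^sub>1"
    and right: "B o\<^sub>C\<^sub>L \<Psi> o\<^sub>C\<^sub>L \<sigma>\<^sub>1 - B\<^sub>1 o\<^sub>C\<^sub>L \<Psi> o\<^sub>C\<^sub>L \<sigma> = \<Psi> o\<^sub>C\<^sub>L \<gamma>"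
    and left: "\<sigma>\<^sub>1 o\<^sub>C\<^sub>L \<Phi> o\<^sub>C\<^sub>L B - \<sigma> o\<^sub>C\<^sub>L \<Phi> o\<^sub>C\<^sub>L B\<^sub>1 = \<gamma>' o\<^sub>C\<^sub>L \<Phi>"
  shows "\<sigma>\<^sub>1 o\<^sub>C\<^sub>L (c *\<^sub>C (\<Phi> o\<^sub>C\<^sub>L \<Psi>)) o\<^sub>C\<^sub>L \<gamma> - \<gamma>' o\<^sub>C\<^sub>L (c *\<^sub>C (\<Phi> o\<^sub>C\<^sub>L \<Psi>)) o\<^sub>C\<^sub>L \<sigma>\<^sub>1 =
    \<sigma> o\<^sub>C\<^sub>L (c *\<^sub>C (\<Phi> o\<^sub>C\<^sub>L B\<^sub>1 o\<^sub>C\<^sub>L \<Psi> o\<^sub>C\<^sub>L \<sigma>\<^sub>1)) - \<sigma>\<^sub>1 o\<^sub>C\<^sub>L (c *\<^sub>C (\<Phi> o\<^sub>C\<^sub>L B\<^sub>1 o\<^sub>C\<^sub>L \<Psi> o\<^sub>C\<^sub>L \<sigma>\<^sub>1)) o\<^sub>C\<^sub>L inv_cblinfun \<sigma>\<^sub>1 o\<^sub>C\<^sub>L \<sigma>"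
proof -
  note assoc = cblinfun_compose_assoc
  have S: "\<sigma>\<^sub>1 o\<^sub>C\<^sub>L (inv_cblinfun \<sigma>\<^sub>1 o\<^sub>C\<^sub>L \<sigma>) = \<sigma>"
    by (simp add: inv_cblinfun[OF inv] flip: assoc)
  have "\<sigma>\<^sub>1 o\<^sub>C\<^sub>L (\<Phi> o\<^sub>C\<^sub>L \<Psi>) o\<^sub>C\<^sub>L \<gamma> - \<gamma>' o\<^sub>C\<^sub>L (\<Phi> o\<^sub>C\<^sub>L \<Psi>) o\<^sub>C\<^sub>L \<sigma>\<^sub>1 =
      \<sigma>\<^sub>1 o\<^sub>C\<^sub>L \<Phi> o\<^sub>C\<^sub>L (\<Psi> o\<^sub>C\<^sub>L \<gamma>) - (\<gamma>' o\<^sub>C\<^sub>L \<Phi>) o\<^sub>C\<^sub>L \<Psi> o\<^sub>C\<^sub>L \<sigma>\<^sub>1"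
    by (simp add: assoc)
  also have "\<dots> = \<sigma> o\<^sub>C\<^sub>L (\<Phi> o\<^sub>C\<^sub>L B\<^sub>1 o\<^sub>C\<^sub>L \<Psi> o\<^sub>C\<^sub>L \<sigma>\<^sub>1)
      - \<sigma>\<^sub>1 o\<^sub>C\<^sub>L (\<Phi> o\<^sub>C\<^sub>L B\<^sub>1 o\<^sub>C\<^sub>L \<Psi> o\<^sub>C\<^sub>L \<sigma>\<^sub>1) o\<^sub>C\<^sub>L inv_cblinfun \<sigma>\<^sub>1 o\<^sub>C\<^sub>L \<sigma>"
    unfolding right[symmetric] left[symmetric]
    by (simp add: assoc S cblinfun_compose_diff_left cblinfun_compose_diff_right)
  finally show ?thesis
    by (simp add: cblinfun_compose_scaleC_left cblinfun_compose_scaleC_right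
        flip: cblinfun_scaleC_diff_right)
qed

theorem proposition4p1:
  fixes d :: nat
    and \<Phi> :: "'h::chilbert_space \<Rightarrow>\<^sub>C\<^sub>L 'e::chilbert_space"
    and A :: "nat \<Rightarrow> 'h \<Rightarrow>\<^sub>C\<^sub>L 'h"
    and \<sigma> :: "nat \<Rightarrow> 'e \<Rightarrow>\<^sub>C\<^sub>L 'e"
    and \<gamma> \<gamma>s :: "nat \<Rightarrow> nat \<Rightarrow> 'e \<Rightarrow>\<^sub>C\<^sub>L 'e"
  assumes "vessel d \<Phi> A \<sigma> \<gamma> \<gamma>s"
    and "invertible_cblinfun (\<sigma> 1)"
  shows "VR_conditions d \<sigma> \<gamma> \<longleftrightarrow> VR_conditions d \<sigma> \<gamma>s"
proof -
  interpret vessel d \<Phi> A \<sigma> \<gamma> \<gamma>s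
    by fact
  have 1: "1 \<in> {1..d}"
    using d_pos by simp
  have neg: "(- \<i>) *\<^sub>C T = - (\<i> *\<^sub>C T)" for T :: "'e \<Rightarrow>\<^sub>C\<^sub>L 'e"
    by transfer (metis mult_minus1 scaleC_minus_one scaleC_scaleC)
  show ?thesis
  proof
    assume VR: "VR_conditions d \<sigma> \<gamma>"
    show "VR_conditions d \<sigma> \<gamma>s"
    proof (rule VR_conditions_perturbation[OF assms(2) _ _ VR])
      fix j k
      assume "j \<in> {1..d}" "k \<in> {1..d}"
      then show "\<gamma>s j k - \<gamma> j k = \<sigma> j o\<^sub>C\<^sub>L (\<i> *\<^sub>C (\<Phi> o\<^sub>C\<^sub>L adj \<Phi>)) o\<^sub>C\<^sub>L \<sigma> k
          - \<sigma> k o\<^sub>C\<^sub>L (\<i> *\<^sub>C (\<Phi> o\<^sub>C\<^sub>L adj \<Phi>)) o\<^sub>C\<^sub>L \<sigma> j"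
        by (simp add: linkage_relation cblinfun_scaleC_diff_right cblinfun_compose_assoc
            cblinfun_compose_scaleC_left cblinfun_compose_scaleC_right)
    \<comment> \<open>The linkage goal has fixed \<open>W\<close>; this rule fixes \<open>Q\<close>,
      with \<open>B = A k\<close> and \<open>B\<^sub>1 = A 1\<close>.\<close>
    qed (rule intertwining_of_relations[OF assms(2) adjoint_input_relation[OF 1]
          output_relation[OF 1]])
  next
    assume VR: "VR_conditions d \<sigma> \<gamma>s"
    show "VR_conditions d \<sigma> \<gamma>"
    proof (rule VR_conditions_perturbation[OF assms(2) _ _ VR])
      fix j k
      assume "j \<in> {1..d}" "k \<in> {1..d}"
      from linkage_relation[OF this]
      show "\<gamma> j k - \<gamma>s j k = \<sigma> j o\<^sub>C\<^sub>L ((- \<i>) *\<^sub>C (\<Phi> o\<^sub>C\<^sub>L adj \<Phi>)) o\<^sub>C\<^sub>L \<sigma> k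
          - \<sigma> k o\<^sub>C\<^sub>L ((- \<i>) *\<^sub>C (\<Phi> o\<^sub>C\<^sub>L adj \<Phi>)) o\<^sub>C\<^sub>L \<sigma> j"
        by (simp add: neg cblinfun_scaleC_diff_right cblinfun_compose_assoc
            cblinfun_compose_scaleC_left cblinfun_compose_scaleC_right algebra_simps)
    \<comment> \<open>With \<open>\<gamma>\<close> and \<open>\<gamma>s\<close> exchanged, the
      output relation is the one to be adjoined, so \<open>B = adj (A k)\<close> and
      \<open>B\<^sub>1 = adj (A 1)\<close>.\<close>
    qed (rule intertwining_of_relations[OF assms(2) adjoint_output_relation[OF 1]
          input_relation[OF 1]])
  qed
qed

end
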